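(* Let $A$ be a finitely generated associative $\mathbb{C}$-algebra with $M_N(A)=0$ for some $N$. Let $\pi:A\to A/M_2(A)$ be the quotient map, $\bar S\subset A/M_2(A)$ a multiplicative subset without zero divisors, and $S=\pi^{-1}(\bar S)$. Then for $k$ odd, $$[A,[A,S^{-1}M_k(A)]]\subset S^{-1}M_{k+2}(A)+M_{k+3}(A[S^{-1}]).$$
   Context: $L_1=A$, $L_k=[A,L_{k-1}]$, $M_k=AL_kA$. $S$ satisfies the Ore condition and $A[S^{-1}]$ is the Ore localization. $S^{-1}M_j(A)$ denotes the subspace of $A[S^{-1}]$ spanned by elements $s^{-1}m$ with $s\in S$, $m\in M_j(A)$, and $[A,[A,V]]$ denotes the span of $[a,[b,v]]$ with $a,b\in A$, $v\in V$. *)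

theory Defs
  imports Complex_Main
begin

definition comm :: "'a::ring \<Rightarrow> 'a \<Rightarrow> 'a" where
  "comm x y = x * y - y * x"

definition calg :: "(complex \<Rightarrow> 'a::{ring,monoid_mult} \<Rightarrow> 'a) \<Rightarrow> bool" where
  "calg sc \<longleftrightarrow> vector_space sc \<and>
     (\<forall>c x y. sc c (x * y) = sc c x * y) \<and> (\<forall>c x y. sc c (x * y) = x * sc c y)"

inductive_set alg_gen :: "(complex \<Rightarrow> 'a::{ring,monoid_mult} \<Rightarrow> 'a) \<Rightarrow> 'a set \<Rightarrow> 'a set"
  for sc X where
  gen: "x \<in> X \<Longrightarrow> x \<in> alg_gen sc X"
| one: "1 \<in> alg_gen sc X"
| add: "x \<in> alg_gen sc X \<Longrightarrow> y \<in> alg_gen sc X \<Longrightarrow> x + y \<in> alg_gen sc X"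
| mult: "x \<in> alg_gen sc X \<Longrightarrow> y \<in> alg_gen sc X \<Longrightarrow> x * y \<in> alg_gen sc X"
| scale: "x \<in> alg_gen sc X \<Longrightarrow> sc c x \<in> alg_gen sc X"

definition fin_gen_alg :: "(complex \<Rightarrow> 'a::{ring,monoid_mult} \<Rightarrow> 'a) \<Rightarrow> bool" where
  "fin_gen_alg sc \<longleftrightarrow> (\<exists>X. finite X \<and> alg_gen sc X = UNIV)"

text \<open>Lower central series: lcs sc k = L_k for k \<ge> 1 (L_1 = A, L_k = [A, L_(k-1)]).\<close>
primrec lcs :: "(complex \<Rightarrow> 'a::{ring,monoid_mult} \<Rightarrow> 'a) \<Rightarrow> nat \<Rightarrow> 'a set" where
  "lcs sc 0 = UNIV"
| "lcs sc (Suc k) = (if k = 0 then UNIV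
      else module.span sc {comm a l | a l. l \<in> lcs sc k})"

definition Mk :: "(complex \<Rightarrow> 'a::{ring,monoid_mult} \<Rightarrow> 'a) \<Rightarrow> nat \<Rightarrow> 'a set" where
  "Mk sc k = module.span sc {a * l * b | a l b. l \<in> lcs sc k}"

definition ring_hom :: "('a::{ring,monoid_mult} \<Rightarrow> 'b::{ring,monoid_mult}) \<Rightarrow> bool" where
  "ring_hom f \<longleftrightarrow> (\<forall>x y. f (x + y) = f x + f y) \<and> (\<forall>x y. f (x * y) = f x * f y) \<and> f 1 = 1"

definition left_ore_localization ::
  "'a::{ring,monoid_mult} set \<Rightarrow> ('a \<Rightarrow> 'b::{ring,monoid_mult}) \<Rightarrow> bool" where
  "left_ore_localization S \<phi> \<longleftrightarrow>
     (\<forall>s\<in>S. \<exists>t. \<phi> s * t = 1 \<and> t * \<phi> s = 1) \<and>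
     (\<forall>b. \<exists>s\<in>S. \<exists>a. \<phi> s * b = \<phi> a) \<and>
     (\<forall>a. \<phi> a = 0 \<longleftrightarrow> (\<exists>s\<in>S. s * a = 0))"

text \<open>S^-1 M: span in B of the elements s^-1 m (i.e. b with phi s * b = phi m).\<close>
definition frac_span :: "(complex \<Rightarrow> 'b::{ring,monoid_mult} \<Rightarrow> 'b) \<Rightarrow> 'a set \<Rightarrow> ('a \<Rightarrow> 'b)
    \<Rightarrow> 'a set \<Rightarrow> 'b set" where
  "frac_span sc S \<phi> M = module.span sc {b. \<exists>s\<in>S. \<exists>m\<in>M. \<phi> s * b = \<phi> m}"

definition dcomm :: "(complex \<Rightarrow> 'b::{ring,monoid_mult} \<Rightarrow> 'b) \<Rightarrow> ('a \<Rightarrow> 'b) \<Rightarrow> 'b set \<Rightarrow> 'b set" where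
  "dcomm sc \<phi> V = module.span sc {comm (\<phi> a) (comm (\<phi> b) v) | a b v. v \<in> V}"

end

theory Submission
  imports Defs
begin

text \<open>The heart of the matter is \<open>[A, M\<^sub>k] \<subseteq> L\<^sub>k\<^sub>+\<^sub>1\<close> for odd \<open>k\<close>, proved by passing
  from \<open>k\<close> to \<open>k + 2\<close>: a degree 5 identity writes \<open>3[a, b[c, [d, u]]]\<close> as a combination of triple
  commutators \<open>[x, [y, [z, w]]]\<close> with \<open>w\<close> in the ideal generated by \<open>u\<close>. By the Jacobi identity
  \<open>[M\<^sub>k, L\<^sub>j] \<subseteq> L\<^sub>k\<^sub>+\<^sub>j\<close>, and \<open>[x, l]m = [xm, l] - x[m, l]\<close> then gives
  \<open>M\<^sub>i M\<^sub>k + M\<^sub>k M\<^sub>i \<subseteq> M\<^sub>i\<^sub>+\<^sub>k\<^sub>-\<^sub>1\<close> for odd \<open>k\<close>.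

  With \<open>t = s\<^sup>-\<^sup>1\<close>, expand \<open>[a, [b, tm]]\<close> using \<open>[x, t] = -t[x, s]t\<close> and move all \<open>t\<close> to the left;
  the corrections lie in \<open>M\<^sub>k\<^sub>+\<^sub>3(A[S\<^sup>-\<^sup>1])\<close>. What remains is symmetric in \<open>a\<close> and \<open>b\<close>, and lies
  in \<open>S\<^sup>-\<^sup>1M\<^sub>k\<^sub>+\<^sub>2(A)\<close> because \<open>[a, c][b, l] + [b, c][a, l] \<in> M\<^sub>k\<^sub>+\<^sub>2\<close> for \<open>l \<in> L\<^sub>k\<close>.\<close>

section \<open>Commutator identities in an arbitrary ring\<close>

lemma comm_anti: "comm x y = - comm y x"
  by (simp add: comm_def)

lemma comm_add_left: "comm (x + y) z = comm x z + comm y z"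
  and comm_add_right: "comm x (y + z) = comm x y + comm x z"
  by (simp_all add: comm_def algebra_simps)

lemma comm_mult_left: "comm (x * y) z = x * comm y z + comm x z * y"
  by (simp add: comm_def algebra_simps)

lemma comm_jacobi: "comm (comm x y) z = comm x (comm y z) - comm y (comm x z)"
  by (simp add: comm_def algebra_simps)

text \<open>The coefficients were found by linear algebra in the multilinear part of the free algebra on
  five letters. What matters is that on the right \<open>u\<close> occurs only innermost, multiplied by at most
  one letter, so that \<open>u\<close> can stand for any element of an ideal \<open>M\<^sub>j\<close>.\<close>

lemma triple_comm_identity:
  fixes a b c d u :: "'a::ring"
  defines "D \<equiv> \<lambda>x y z w. comm x (comm y (comm z w))"
    and "X \<equiv> comm a (b * comm c (comm d u))"
  shows
    "X + X + X =
     D a b c (d*u) + D a (b*d) c u + D a c d (u*b) + D a d b (u*c)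
     + D (a*b) c d u + D (a*b) c d u + D b a d (u*c) + D b c a (d*u)
     + D b d c (u*a) + D (b*c) a d u + D c (a*d) b u + D c (a*d) b u
     + D (c*d) b a u + D d a b (c*u) + D d a b (c*u) + D d b c (a*u)
     + D d b c (a*u) + D d c a (b*u) + D d c a (b*u)
     - (D (a*b) d c u + D b (c*a) d u + D b (c*a) d u + D c a d (b*u)
     + D c b a (u*d) + D c d b (a*u) + D (c*a) d b u + D d (b*c) a u
     + D (d*a) b c u + D (d*a) b c u + D (d*b) c a u + D (d*c) a b u
     + D (d*c) a b u)"
  unfolding D_def X_def comm_def by (simp add: algebra_simps)

declare lcs.simps(2) [simp del]

lemma lcs_one [simp]: "lcs sc (Suc 0) = UNIV"
  by (simp add: lcs.simps)

lemma lcs_Suc: "k \<ge> 1 \<Longrightarrow> lcs sc (Suc k) = module.span sc {comm a l | a l. l \<in> lcs sc k}"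
  by (simp add: lcs.simps)

section \<open>Lower central series and the ideals it generates\<close>

locale complex_algebra =
  fixes sc :: "complex \<Rightarrow> 'a::{ring,monoid_mult} \<Rightarrow> 'a"
  assumes calg: "calg sc"
begin

sublocale vector_space sc
  using calg by (simp add: calg_def)

lemma scale_mult_left: "sc c x * y = sc c (x * y)"
  and scale_mult_right: "x * sc c y = sc c (x * y)"
  using calg unfolding calg_def by metis+

lemma comm_scale_left: "comm (sc c x) y = sc c (comm x y)"
  and comm_scale_right: "comm x (sc c y) = sc c (comm x y)"
  by (simp_all add: comm_def scale_mult_left scale_mult_right scale_right_diff_distrib)

lemmas bilinear_simps =
  comm_add_left comm_add_right comm_scale_left comm_scale_right
  scale_mult_left scale_mult_right distrib_left distrib_right

lemma subspace_triple_cancel: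
  assumes "subspace V" "x + x + x \<in> V"
  shows "x \<in> V"
proof -
  have "sc (1/3) (x + x + x) = sc (1/3 + 1/3 + 1/3) x"
    by (simp only: scale_left_distrib scale_right_distrib)
  also have "\<dots> = x"
    by simp
  finally show ?thesis
    using subspace_scale[OF assms, of "1/3"] by simp
qed

text \<open>Makes a linear condition a subspace, so that it need only be checked on the generators
  of a span.\<close>

lemma subspace_preimage:
  assumes "subspace V" "\<And>x y. f (x + y) = f x + f y" "\<And>c x. f (sc c x) = sc c (f x)"
  shows "subspace {x. f x \<in> V}"
proof -
  have "f 0 = 0" using assms(2)[of 0 0] by simp
  with assms show ?thesis by (auto simp: subspace_def)
qed

lemma subspace_lcs: "subspace (lcs sc k)"
  by (cases k) (auto simp: lcs.simps subspace_UNIV subspace_span)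

lemma subspace_Mk: "subspace (Mk sc k)"
  by (simp add: Mk_def subspace_span)

lemmas lcs_add = subspace_add[OF subspace_lcs]
  and lcs_diff = subspace_diff[OF subspace_lcs]
  and lcs_neg = subspace_neg[OF subspace_lcs]
  and Mk_add = subspace_add[OF subspace_Mk]
  and Mk_diff = subspace_diff[OF subspace_Mk]

lemma comm_in_lcs:
  assumes "l \<in> lcs sc k" "k \<ge> 1"
  shows "comm a l \<in> lcs sc (Suc k)" "comm l a \<in> lcs sc (Suc k)"
proof -
  show *: "comm a l \<in> lcs sc (Suc k)"
    using assms by (auto simp: lcs_Suc intro!: span_base)
  show "comm l a \<in> lcs sc (Suc k)"
    using lcs_neg[OF *] comm_anti[of l a] by simp
qed

lemma lcs_Suc_subset:
  assumes "k \<ge> 1" "subspace V" "\<And>a l. l \<in> lcs sc k \<Longrightarrow> comm a l \<in> V"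
  shows "lcs sc (Suc k) \<subseteq> V"
  unfolding lcs_Suc[OF assms(1)] using assms by (intro span_minimal) auto

lemma lcs_Suc_mono: "lcs sc (Suc k) \<subseteq> lcs sc k"
proof (induction k)
  case (Suc k)
  show ?case
  proof (cases "k = 0")
    case False
    then show ?thesis
      by (intro lcs_Suc_subset subspace_lcs comm_in_lcs) (use Suc in auto)
  qed simp
qed simp

lemma Mk_base: "l \<in> lcs sc k \<Longrightarrow> a * l * b \<in> Mk sc k"
  unfolding Mk_def by (intro span_base) blast

lemma lcs_subset_Mk: "lcs sc k \<subseteq> Mk sc k"
  using Mk_base[of _ k 1 1] by auto

lemma Mk_subset:
  assumes "subspace V" "\<And>a l b. l \<in> lcs sc k \<Longrightarrow> a * l * b \<in> V"
  shows "Mk sc k \<subseteq> V"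
  unfolding Mk_def using assms by (intro span_minimal) auto

lemma Mk_mult_left:
  assumes "m \<in> Mk sc k"
  shows "a * m \<in> Mk sc k"
proof -
  have "Mk sc k \<subseteq> {m. a * m \<in> Mk sc k}"
    using Mk_base[of _ k "a * _"]
    by (intro Mk_subset subspace_preimage subspace_Mk) (simp_all add: bilinear_simps mult.assoc)
  then show ?thesis using assms by blast
qed

lemma Mk_mult_right:
  assumes "m \<in> Mk sc k"
  shows "m * a \<in> Mk sc k"
proof -
  have "Mk sc k \<subseteq> {m. m * a \<in> Mk sc k}"
    using Mk_base[of _ k _ "_ * a"]
    by (intro Mk_subset subspace_preimage subspace_Mk) (simp_all add: bilinear_simps mult.assoc)
  then show ?thesis using assms by blast
qed

text \<open>\<open>a * l * b = (a * b) * l + a * comm l b\<close>, and \<open>comm l b\<close> stays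
  in \<open>lcs sc k\<close> because the series descends; so left multiples already span the
  ideal.\<close>

lemma Mk_subset_left:
  assumes "k \<ge> 1" "subspace V" "\<And>a l. l \<in> lcs sc k \<Longrightarrow> a * l \<in> V"
  shows "Mk sc k \<subseteq> V"
proof (rule Mk_subset[OF assms(2)])
  fix a l b assume l: "l \<in> lcs sc k"
  have "comm l b \<in> lcs sc k"
    using comm_in_lcs(2)[OF l assms(1)] lcs_Suc_mono by blast
  then have "(a * b) * l + a * comm l b \<in> V"
    using l assms subspace_add by blast
  also have "(a * b) * l + a * comm l b = a * l * b"
    by (simp add: comm_def algebra_simps)
  finally show "a * l * b \<in> V" .
qed

lemma Mk_subset_right:
  assumes "k \<ge> 1" "subspace V" "\<And>a l. l \<in> lcs sc k \<Longrightarrow> l * a \<in> V"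
  shows "Mk sc k \<subseteq> V"
proof (rule Mk_subset[OF assms(2)])
  fix a l b assume l: "l \<in> lcs sc k"
  have "comm a l \<in> lcs sc k"
    using comm_in_lcs(1)[OF l assms(1)] lcs_Suc_mono by blast
  then have "l * (a * b) + comm a l * b \<in> V"
    using l assms subspace_add by blast
  also have "l * (a * b) + comm a l * b = a * l * b"
    by (simp add: comm_def algebra_simps)
  finally show "a * l * b \<in> V" .
qed

section \<open>Commutators and products across the filtration\<close>

lemma lcs_comm:
  assumes "x \<in> lcs sc i" "y \<in> lcs sc j" "i \<ge> 1" "j \<ge> 1"
  shows "comm x y \<in> lcs sc (i + j)"
  using assms(3,1,2,4)
proof (induction i arbitrary: x y j rule: nat_induct_at_least)
  case base
  then show ?case using comm_in_lcs(1)[of y j x] by simp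
next
  case (Suc i)
  have "lcs sc (Suc i) \<subseteq> {x. comm x y \<in> lcs sc (Suc i + j)}"
  proof (rule lcs_Suc_subset)
    show "subspace {x. comm x y \<in> lcs sc (Suc i + j)}"
      by (rule subspace_preimage[OF subspace_lcs]) (simp_all add: bilinear_simps)
    fix a l assume l: "l \<in> lcs sc i"
    have "comm a (comm l y) \<in> lcs sc (Suc (i + j))"
      using Suc l by (intro comm_in_lcs) auto
    moreover have "comm l (comm a y) \<in> lcs sc (i + Suc j)"
      using Suc l by (intro Suc.IH comm_in_lcs) auto
    ultimately show "comm a l \<in> {x. comm x y \<in> lcs sc (Suc i + j)}"
      using lcs_diff by (auto simp: comm_jacobi)
  qed (use Suc in auto)
  then show ?case using Suc by blast
qed

text \<open>Induction in steps of two from \<open>k = 1\<close>, where the ideal is the whole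
  algebra and the claim is the definition of \<open>lcs sc 2\<close>; hence only odd
  \<open>k\<close> are reached.\<close>

lemma comm_Mk_odd:
  assumes "odd k" "m \<in> Mk sc k"
  shows "comm a m \<in> lcs sc (Suc k)"
  using assms
proof (induction k arbitrary: a m rule: less_induct)
  case (less k)
  show ?case
  proof (cases "k = 1")
    case True
    then show ?thesis using comm_in_lcs(1)[of m 1 a] by simp
  next
    case False
    with less.prems obtain j where k: "k = j + 2" and j: "odd j"
      by (metis One_nat_def add_2_eq_Suc' even_Suc nat.exhaust odd_pos less_numeral_extra(3))
    then have j1: "j \<ge> 1" by (cases j) auto
    \<comment> \<open>The elements \<open>comm c (comm d u)\<close> span \<open>lcs sc k\<close>,
      and their left multiples span the ideal, so this is the claim on generators.\<close>
    have key: "comm a (b * comm c (comm d u)) \<in> lcs sc (Suc k)" if u: "u \<in> lcs sc j" for a b c d u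
    proof -
      \<comment> \<open>The induction hypothesis puts \<open>comm z w\<close> in
        \<open>lcs sc (j + 1)\<close>; two more commutators reach \<open>j + 3 = Suc k\<close>. All
        terms of the identity have this shape, since the ideal absorbs the letter next to
        \<open>u\<close>.\<close>
      have W: "comm x (comm y (comm z w)) \<in> lcs sc (Suc k)" if "w \<in> Mk sc j" for x y z w
        using comm_in_lcs(1)[OF comm_in_lcs(1)[OF less.IH[of j w z]], of x y] that j k by simp
      have u: "u \<in> Mk sc j" using u lcs_subset_Mk by blast
      note W = W[OF u] W[OF Mk_mult_left[OF u]] W[OF Mk_mult_right[OF u]]
      show ?thesis
        by (rule subspace_triple_cancel[OF subspace_lcs], subst triple_comm_identity)
          (intro lcs_diff lcs_add W)
    qed
    have "Mk sc k \<subseteq> {x. comm a x \<in> lcs sc (Suc k)}"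
    proof (rule Mk_subset_left)
      fix b l assume "l \<in> lcs sc k"
      moreover have "lcs sc (Suc (Suc j)) \<subseteq> {l. comm a (b * l) \<in> lcs sc (Suc k)}"
      proof (rule lcs_Suc_subset)
        fix c l assume l: "l \<in> lcs sc (Suc j)"
        have "lcs sc (Suc j) \<subseteq> {l. comm a (b * comm c l) \<in> lcs sc (Suc k)}"
          by (rule lcs_Suc_subset[OF j1 subspace_preimage[OF subspace_lcs]])
            (simp_all add: bilinear_simps key)
        then show "comm c l \<in> {l. comm a (b * l) \<in> lcs sc (Suc k)}"
          using l by blast
      qed (simp, rule subspace_preimage[OF subspace_lcs], simp_all add: bilinear_simps)
      ultimately show "b * l \<in> {x. comm a x \<in> lcs sc (Suc k)}"
        using k by auto
    qed (use k in \<open>auto intro!: subspace_preimage[OF subspace_lcs] simp: bilinear_simps\<close>)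
    then show ?thesis using less.prems by blast
  qed
qed

text \<open>Induction on \<open>j\<close> from \<open>comm_Mk_odd\<close>. In the Jacobi step
  \<open>comm a m\<close> already lies in \<open>lcs sc (Suc k)\<close>, so \<open>lcs_comm\<close>
  handles \<open>comm (comm a m) l\<close>.\<close>

lemma comm_Mk_lcs:
  assumes "odd k" "m \<in> Mk sc k" "l \<in> lcs sc j" "j \<ge> 1"
  shows "comm m l \<in> lcs sc (k + j)"
  using assms(4,3)
proof (induction j arbitrary: l rule: nat_induct_at_least)
  case base
  then show ?case
    using lcs_neg[OF comm_Mk_odd[OF assms(1,2), of l]] comm_anti[of m l] by simp
next
  case (Suc j)
  have "lcs sc (Suc j) \<subseteq> {l. comm m l \<in> lcs sc (k + Suc j)}"
  proof (rule lcs_Suc_subset)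
    show "subspace {l. comm m l \<in> lcs sc (k + Suc j)}"
      by (rule subspace_preimage[OF subspace_lcs]) (simp_all add: bilinear_simps)
    fix a l assume l: "l \<in> lcs sc j"
    have "comm a (comm m l) \<in> lcs sc (Suc (k + j))"
      using Suc l by (intro comm_in_lcs) auto
    moreover have "comm (comm a m) l \<in> lcs sc (Suc k + j)"
      using Suc l assms by (intro lcs_comm comm_Mk_odd) auto
    moreover have "comm m (comm a l) = comm a (comm m l) - comm (comm a m) l"
      by (simp add: comm_jacobi)
    ultimately show "comm a l \<in> {l. comm m l \<in> lcs sc (k + Suc j)}"
      using lcs_diff by auto
  qed (use Suc in auto)
  then show ?case using Suc by blast
qed

lemma Mk_mult_odd:
  assumes "odd k" "x \<in> Mk sc (Suc i)" "y \<in> Mk sc k"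
  shows "x * y \<in> Mk sc (k + i)" "y * x \<in> Mk sc (k + i)"
proof -
  have "x * y \<in> Mk sc (k + i) \<and> y * x \<in> Mk sc (k + i)"
  \<comment> \<open>\<open>lcs sc 1\<close> is not given as a span of commutators, so
    \<open>i = 0\<close> is treated apart; there the ideal property of \<open>Mk sc k\<close>
    suffices.\<close>
  proof (cases "i = 0")
    case True
    then show ?thesis using Mk_mult_left Mk_mult_right assms by simp
  next
    case False
    then have i: "i \<ge> 1" by simp
    have L: "l * y \<in> Mk sc (k + i) \<and> y * l \<in> Mk sc (k + i)"
      if "y \<in> Mk sc k" "l \<in> lcs sc (Suc i)" for l y
    proof -
      have "lcs sc (Suc i) \<subseteq> {l. l * y \<in> Mk sc (k + i) \<and> y * l \<in> Mk sc (k + i)}"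
      proof (rule lcs_Suc_subset[OF i])
        show "subspace {l. l * y \<in> Mk sc (k + i) \<and> y * l \<in> Mk sc (k + i)}"
          using subspace_Mk[of "k + i"] by (auto simp: subspace_def bilinear_simps)
        fix a l assume l: "l \<in> lcs sc i"
        have C: "comm m l \<in> Mk sc (k + i)" if "m \<in> Mk sc k" for m
          using comm_Mk_lcs[OF assms(1) that l i] lcs_subset_Mk by blast
        have "comm a l * y = comm (a * y) l - a * comm y l"
          and "y * comm a l = comm (y * a) l - comm y l * a"
          by (simp_all add: comm_mult_left)
        then show "comm a l \<in> {l. l * y \<in> Mk sc (k + i) \<and> y * l \<in> Mk sc (k + i)}"
          using that Mk_diff[OF C Mk_mult_left[OF C]] Mk_diff[OF C Mk_mult_right[OF C]]
          by (simp add: Mk_mult_left Mk_mult_right)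
      qed
      then show ?thesis using that by blast
    qed
    have S: "subspace {x. x * y \<in> Mk sc (k + i)}" "subspace {x. y * x \<in> Mk sc (k + i)}"
      by (rule subspace_preimage[OF subspace_Mk]; simp add: bilinear_simps)+
    have "Mk sc (Suc i) \<subseteq> {x. x * y \<in> Mk sc (k + i)}"
      using L assms Mk_mult_left
      by (intro Mk_subset_left S) (auto simp: mult.assoc)
    moreover have "Mk sc (Suc i) \<subseteq> {x. y * x \<in> Mk sc (k + i)}"
      using L assms Mk_mult_right
      by (intro Mk_subset_right S) (auto simp flip: mult.assoc)
    ultimately show ?thesis using assms by blast
  qed
  then show "x * y \<in> Mk sc (k + i)" "y * x \<in> Mk sc (k + i)" by auto
qed

section \<open>Double commutators, symmetrized products and inverses\<close>

lemma comm_comm_in_Mk: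
  assumes "l \<in> lcs sc k" "k \<ge> 1"
  shows "comm a (comm b l) \<in> Mk sc (k + 2)" "comm (comm l a) b \<in> Mk sc (k + 2)"
  using comm_in_lcs(1)[OF comm_in_lcs(1)[OF assms], of a b]
    comm_in_lcs(2)[OF comm_in_lcs(2)[OF assms], of a b] assms(2) lcs_subset_Mk[of "k + 2"]
  by auto

text \<open>Besides double commutators of \<open>l\<close>, the Leibniz expansion of
  \<open>comm (comm l (c * a)) b\<close> contains
  \<open>comm l c * comm a b + comm c b * comm l a\<close>. The first product is antisymmetric in
  \<open>a\<close> and \<open>b\<close> and cancels on symmetrizing.\<close>

lemma comm_mult_comm_sym:
  assumes "l \<in> lcs sc k" "k \<ge> 1"
  shows "comm a c * comm b l + comm b c * comm a l \<in> Mk sc (k + 2)"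
proof -
  let ?f = "\<lambda>a b. comm (comm l (c * a)) b - comm (comm l c) b * a - c * comm (comm l a) b"
  have "?f a b + ?f b a \<in> Mk sc (k + 2)"
    by (intro Mk_add Mk_diff Mk_mult_left Mk_mult_right comm_comm_in_Mk assms)
  also have "?f a b + ?f b a = comm a c * comm b l + comm b c * comm a l"
    by (simp add: comm_def algebra_simps)
  finally show ?thesis .
qed

lemma comm_in_Mk: "comm a b \<in> Mk sc 2"
  using comm_in_lcs(1)[of b 1 a] lcs_subset_Mk[of 2] by (auto simp: numeral_2_eq_2)

lemma comm_comm_in_Mk3: "comm a (comm b c) \<in> Mk sc 3" "comm (comm a b) c \<in> Mk sc 3"
  using comm_comm_in_Mk[of _ 1] by (auto simp: numeral_3_eq_3)

lemma Mk2_Mk3: "x \<in> Mk sc 2 \<Longrightarrow> y \<in> Mk sc 3 \<Longrightarrow> x * y \<in> Mk sc 4"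
    "x \<in> Mk sc 2 \<Longrightarrow> y \<in> Mk sc 3 \<Longrightarrow> y * x \<in> Mk sc 4"
  using Mk_mult_odd[of 3 x 1 y] by (simp_all flip: numeral_2_eq_2)

text \<open>The odd factor is 3, so \<open>k\<close> may be even; in \<open>Mk4_mult\<close> the odd
  factor has to be \<open>k\<close>.\<close>

lemma Mk3_mult: "x \<in> Mk sc 3 \<Longrightarrow> y \<in> Mk sc k \<Longrightarrow> k \<ge> 1 \<Longrightarrow> x * y \<in> Mk sc (k + 2)"
  using Mk_mult_odd(2)[of 3 y "k - 1" x] by (auto simp: add.commute)

lemma Mk4_mult: "x \<in> Mk sc 4 \<Longrightarrow> y \<in> Mk sc k \<Longrightarrow> odd k \<Longrightarrow> x * y \<in> Mk sc (k + 3)"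
  using Mk_mult_odd(1)[of k x 3 y] by simp

lemma comm_Mk_Suc: "odd k \<Longrightarrow> m \<in> Mk sc k \<Longrightarrow> comm a m \<in> Mk sc (Suc k)"
  using comm_Mk_odd lcs_subset_Mk by blast

lemma double_comm_Mk:
  assumes "odd k" "m \<in> Mk sc k"
  shows "comm a (comm b m) \<in> Mk sc (k + 2)"
  using comm_in_lcs(1)[OF comm_Mk_odd[OF assms], of a b] lcs_subset_Mk[of "k + 2"] by auto

lemma comm_mult_comm_Mk_sym:
  assumes "odd k" "m \<in> Mk sc k"
  shows "comm a s * comm b m + comm b s * comm a m \<in> Mk sc (k + 2)"
proof -
  have k: "k \<ge> 1" using assms(1) by (cases k) auto
  have "Mk sc k \<subseteq> {m. comm a s * comm b m + comm b s * comm a m \<in> Mk sc (k + 2)}"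
  proof (rule Mk_subset_left[OF k])
    show "subspace {m. comm a s * comm b m + comm b s * comm a m \<in> Mk sc (k + 2)}"
      by (rule subspace_preimage[OF subspace_Mk]) (simp_all add: bilinear_simps scale_right_distrib)
    fix c l assume l: "l \<in> lcs sc k"
    \<comment> \<open>The bracket is the degree one case of \<open>comm_mult_comm_sym\<close>, hence
      in \<open>Mk sc 3\<close>.\<close>
    have 1: "(comm a s * comm b c + comm b s * comm a c) * l \<in> Mk sc (k + 2)"
      using comm_mult_comm_sym[of c 1 a s b] l k lcs_subset_Mk[of k]
      by (intro Mk3_mult) (auto simp: numeral_3_eq_3)
    have 2: "c * (comm a s * comm b l + comm b s * comm a l) \<in> Mk sc (k + 2)"
      by (intro Mk_mult_left comm_mult_comm_sym l k)
    \<comment> \<open>The error from moving \<open>c\<close> to the left past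
      \<open>comm x s\<close>.\<close>
    have 3: "comm (comm x s) c * comm y l \<in> Mk sc (k + 2)" for x y
    proof -
      have "comm y l \<in> Mk sc k"
        using comm_in_lcs(1)[OF l k, of y] lcs_Suc_mono lcs_subset_Mk by blast
      then show ?thesis by (intro Mk3_mult comm_comm_in_Mk3 k)
    qed
    have "comm a s * comm b (c * l) + comm b s * comm a (c * l) =
        (comm a s * comm b c + comm b s * comm a c) * l
        + c * (comm a s * comm b l + comm b s * comm a l)
        + (comm (comm a s) c * comm b l + comm (comm b s) c * comm a l)"
      by (simp add: comm_def algebra_simps)
    then show "c * l \<in> {m. comm a s * comm b m + comm b s * comm a m \<in> Mk sc (k + 2)}"
      using Mk_add[OF Mk_add[OF 1 2] Mk_add[OF 3 3]] by simp
  qed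
  then show ?thesis using assms by blast
qed

text \<open>Moving \<open>t = s\<^sup>-\<^sup>1\<close> to the left past a commutator raises the total filtration degree by one,
  so all such corrections land in degree \<open>k + 3\<close>.\<close>

lemma double_comm_inverse:
  assumes ts: "t * s = 1" "s * t = 1" and "odd k" "m \<in> Mk sc k"
  shows "comm a (comm b (t * m)) -
     (t * comm a (comm b m)
      - t * t * (comm a s * comm b m + comm b s * comm a m)
      - t * t * (comm a (comm b s) * m)
      + t * t * t * ((comm a s * comm b s + comm b s * comm a s) * m)) \<in> Mk sc (k + 3)"
proof -
  have inv: "comm x t = - (t * comm x s * t)" for x
  proof -
    have "- (t * comm x s * t) = - (t * x * (s * t)) + (t * s) * x * t"
      by (simp add: comm_def algebra_simps)
    then show ?thesis by (simp add: ts comm_def)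
  qed
  \<comment> \<open>Errors from moving inner factors \<open>t\<close> to the front:
    \<open>?q\<close> when two commutators of \<open>s\<close> occur, \<open>?p\<close> for a
    product of commutators of \<open>s\<close> and \<open>m\<close>.\<close>
  let ?q = "\<lambda>x y. t * comm x s * t * comm y s * t - t * t * t * (comm x s * comm y s)"
  let ?p = "\<lambda>x y. t * comm (comm x s) t * comm y m"
  \<comment> \<open>Since \<open>k\<close> is odd, \<open>comm y m\<close> has degree
    \<open>k + 1\<close>; the double commutator adds two.\<close>
  have p: "?p x y \<in> Mk sc (k + 3)" for x y
    using Mk3_mult[OF Mk_mult_left[OF comm_comm_in_Mk3(2)] comm_Mk_Suc[OF assms(3,4)]]
    by (simp add: numeral_3_eq_3)
  have q: "?q x y * m \<in> Mk sc (k + 3)" for x y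
  proof -
    \<comment> \<open>Moving \<open>t\<close> past one commutator at a time pairs, in each summand,
      a double commutator in \<open>Mk sc 3\<close> with a single one in
      \<open>Mk sc 2\<close>.\<close>
    have "?q x y = t * (comm x s * (t * comm (comm y s) t)
        + (comm (comm x s) t * t + t * comm (comm x s) t) * comm y s)"
      by (simp add: comm_def algebra_simps)
    also have "\<dots> \<in> Mk sc 4"
      by (rule Mk_mult_left[OF Mk_add[OF
            Mk2_Mk3(1)[OF comm_in_Mk Mk_mult_left[OF comm_comm_in_Mk3(2)]]
            Mk2_Mk3(2)[OF comm_in_Mk Mk_add[OF
              Mk_mult_right[OF comm_comm_in_Mk3(2)] Mk_mult_left[OF comm_comm_in_Mk3(2)]]]]])
    finally show ?thesis using assms Mk4_mult by blast
  qed
  have r: "t * comm (comm a (comm b s)) t * m \<in> Mk sc (k + 3)"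
  proof (rule Mk4_mult)
    have "comm b s \<in> lcs sc 2"
      using comm_in_lcs(1)[of s 1 b] by (auto simp: numeral_2_eq_2)
    from comm_in_lcs(2)[OF comm_in_lcs(1)[OF this], of a t]
    have "comm (comm a (comm b s)) t \<in> lcs sc 4" by (simp add: eval_nat_numeral)
    then show "t * comm (comm a (comm b s)) t \<in> Mk sc 4"
      using lcs_subset_Mk Mk_mult_left by blast
  qed (use assms in auto)
  have "comm a (comm b t) = - (comm a t * comm b s * t + t * comm a (comm b s) * t + t * comm b s * comm a t)"
    unfolding inv[of b] by (simp add: comm_def algebra_simps)
  also have "\<dots> = t * comm a s * t * comm b s * t + t * comm b s * t * comm a s * t
      - t * comm a (comm b s) * t"
    unfolding inv[of a] by (simp add: algebra_simps)
  finally have abt: "comm a (comm b t) = \<dots>" .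
  have "comm a (comm b (t * m)) =
      t * comm a (comm b m) + comm a t * comm b m + comm b t * comm a m + comm a (comm b t) * m"
    by (simp add: comm_def algebra_simps)
  then have "comm a (comm b (t * m)) -
     (t * comm a (comm b m)
      - t * t * (comm a s * comm b m + comm b s * comm a m)
      - t * t * (comm a (comm b s) * m)
      + t * t * t * ((comm a s * comm b s + comm b s * comm a s) * m))
    = ?q a b * m + ?q b a * m - t * comm (comm a (comm b s)) t * m - ?p a b - ?p b a"
    unfolding abt unfolding inv[of a] inv[of b] unfolding comm_def[of _ t] by (simp add: algebra_simps)
  then show ?thesis
    using Mk_diff[OF Mk_diff[OF Mk_diff[OF Mk_add[OF q q] r] p] p] by simp
qed

end

section \<open>Passage to the localization\<close>

lemma ring_hom_comm:
  assumes "ring_hom \<phi>"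
  shows "\<phi> (comm x y) = comm (\<phi> x) (\<phi> y)"
proof -
  have "\<phi> (x - y) = \<phi> x - \<phi> y" for x y
    using assms unfolding ring_hom_def by (metis add_diff_cancel diff_add_cancel)
  then show ?thesis using assms by (simp add: comm_def ring_hom_def)
qed

text \<open>Allows \<open>double_comm_inverse\<close> to be applied in the localization to the image
  of an \<open>m\<close> from the original algebra.\<close>

lemma ring_hom_Mk:
  assumes "calg scA" "calg scB" "ring_hom \<phi>" "\<And>c a. \<phi> (scA c a) = scB c (\<phi> a)"
    and "m \<in> Mk scA k"
  shows "\<phi> m \<in> Mk scB k"
proof -
  interpret A: complex_algebra scA by unfold_locales fact
  interpret B: complex_algebra scB by unfold_locales fact
  have hom: "\<phi> (x + y) = \<phi> x + \<phi> y" "\<phi> (x * y) = \<phi> x * \<phi> y" for x y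
    using assms(3) by (simp_all add: ring_hom_def)
  have "\<phi> 0 = 0" using hom(1)[of 0 0] by simp
  then have sub: "A.subspace (\<phi> -` V)" if "B.subspace V" for V
    using that by (auto simp: A.subspace_def B.subspace_def hom assms(4))
  have lcs: "\<phi> l \<in> lcs scB k" if "l \<in> lcs scA k" for l k
    using that
  proof (induction k arbitrary: l)
    case (Suc k)
    show ?case
    proof (cases "k = 0")
      case False
      have "lcs scA (Suc k) \<subseteq> \<phi> -` lcs scB (Suc k)"
        using False Suc.IH
        by (intro A.lcs_Suc_subset sub B.subspace_lcs)
          (auto simp: ring_hom_comm[OF assms(3)] B.comm_in_lcs(1))
      then show ?thesis using Suc.prems by blast
    qed simp
  qed simp
  have "Mk scA k \<subseteq> \<phi> -` Mk scB k"
  proof (rule A.Mk_subset[OF sub[OF B.subspace_Mk]])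
    fix a l b assume "l \<in> lcs scA k"
    then have "\<phi> l \<in> Mk scB k" using lcs B.lcs_subset_Mk by blast
    then show "a * l * b \<in> \<phi> -` Mk scB k"
      by (simp add: hom B.Mk_mult_left B.Mk_mult_right)
  qed
  then show ?thesis using assms by blast
qed

theorem theorem3p7:
  fixes scA :: "complex \<Rightarrow> 'a::{ring,monoid_mult} \<Rightarrow> 'a"
    and \<pi> :: "'a \<Rightarrow> 'q::{ring,monoid_mult}"
    and Sbar :: "'q set"
    and scB :: "complex \<Rightarrow> 'b::{ring,monoid_mult} \<Rightarrow> 'b"
    and \<phi> :: "'a \<Rightarrow> 'b"
    and k :: nat
  assumes "calg scA" and "fin_gen_alg scA" and "\<exists>N. Mk scA N = {0}"
    and "ring_hom \<pi>" and "surj \<pi>" and "{a. \<pi> a = 0} = Mk scA 2"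
    and "1 \<in> Sbar" and "\<forall>x\<in>Sbar. \<forall>y\<in>Sbar. x * y \<in> Sbar"
    and "\<forall>s\<in>Sbar. \<forall>x. (s * x = 0 \<or> x * s = 0) \<longrightarrow> x = 0"
    and "calg scB" and "ring_hom \<phi>" and "\<forall>c a. \<phi> (scA c a) = scB c (\<phi> a)"
    and "left_ore_localization (\<pi> -` Sbar) \<phi>"
    and "odd k"
  shows "dcomm scB \<phi> (frac_span scB (\<pi> -` Sbar) \<phi> (Mk scA k))
      \<subseteq> {x + y | x y. x \<in> frac_span scB (\<pi> -` Sbar) \<phi> (Mk scA (k + 2)) \<and> y \<in> Mk scB (k + 3)}"
proof -
  interpret A: complex_algebra scA by unfold_locales fact
  interpret B: complex_algebra scB by unfold_locales fact
  let ?S = "\<pi> -` Sbar"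
  let ?F = "frac_span scB ?S \<phi> (Mk scA (k + 2))"
  let ?V = "{x + y | x y. x \<in> ?F \<and> y \<in> Mk scB (k + 3)}"
  have hom: "\<phi> (x + y) = \<phi> x + \<phi> y" "\<phi> (x * y) = \<phi> x * \<phi> y" for x y
    using assms(11) by (simp_all add: ring_hom_def)
  note hom_comm = ring_hom_comm[OF \<open>ring_hom \<phi>\<close>]
  have S_mult: "s * s' \<in> ?S" if "s \<in> ?S" "s' \<in> ?S" for s s'
    using that assms(4,8) by (simp add: ring_hom_def)
  have F: "B.subspace ?F" by (simp add: frac_span_def)
  have V: "B.subspace ?V"
    using B.subspace_sums[OF F B.subspace_Mk] .
  \<comment> \<open>Here \<open>t\<close> is arbitrary, so that the square and cube of an inverse
    can be used with denominators \<open>s * s\<close> and \<open>s * s * s\<close>.\<close>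
  have F_base: "t * \<phi> m \<in> ?F" if "s \<in> ?S" "\<phi> s * t = 1" "m \<in> Mk scA (k + 2)" for s t m
  proof -
    have "\<phi> s * (t * \<phi> m) = \<phi> m" using that by (simp flip: mult.assoc)
    then show ?thesis unfolding frac_span_def using that by (intro B.span_base) blast
  qed
  have main: "comm (\<phi> a) (comm (\<phi> b) v) \<in> ?V"
    if s: "s \<in> ?S" and m: "m \<in> Mk scA k" and v: "\<phi> s * v = \<phi> m" for a b v s m
  proof -
    obtain t where t: "t * \<phi> s = 1" "\<phi> s * t = 1"
      using s \<open>left_ore_localization ?S \<phi>\<close> unfolding left_ore_localization_def by blast
    have "v = t * \<phi> s * v" by (simp add: t)
    then have v: "v = t * \<phi> m" by (simp add: v mult.assoc)
    have "\<phi> (s * s) * (t * t) = \<phi> s * (\<phi> s * t) * t"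
      by (simp add: hom mult.assoc)
    then have t2: "\<phi> (s * s) * (t * t) = 1" by (simp add: t)
    have "\<phi> (s * s * s) * (t * t * t) = \<phi> s * (\<phi> s * (\<phi> s * t) * t) * t"
      by (simp add: hom mult.assoc)
    then have t3: "\<phi> (s * s * s) * (t * t * t) = 1" by (simp add: t)
    \<comment> \<open>The leading part in \<open>double_comm_inverse\<close>, with numerators pulled
      back along \<open>\<phi>\<close>; each of them lies in \<open>Mk scA (k + 2)\<close>.\<close>
    let ?G = "t * \<phi> (comm a (comm b m))
      - t * t * \<phi> (comm a s * comm b m + comm b s * comm a m)
      - t * t * \<phi> (comm a (comm b s) * m)
      + t * t * t * \<phi> ((comm a s * comm b s + comm b s * comm a s) * m)"
    have k: "k \<ge> 1" using \<open>odd k\<close> by (cases k) auto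
    \<comment> \<open>\<open>comm_mult_comm_sym\<close> in degree one, with \<open>s\<close> in the
      roles of both \<open>c\<close> and \<open>l\<close>.\<close>
    have c3: "comm a s * comm b s + comm b s * comm a s \<in> Mk scA 3"
      using A.comm_mult_comm_sym[of s 1 a s b] by (simp add: numeral_3_eq_3)
    have "?G \<in> ?F"
      by (intro B.subspace_add[OF F] B.subspace_diff[OF F]
          F_base[OF s t(2) A.double_comm_Mk[OF \<open>odd k\<close> m]]
          F_base[OF S_mult[OF s s] t2 A.comm_mult_comm_Mk_sym[OF \<open>odd k\<close> m]]
          F_base[OF S_mult[OF s s] t2 A.Mk3_mult[OF A.comm_comm_in_Mk3(1) m k]]
          F_base[OF S_mult[OF S_mult[OF s s] s] t3 A.Mk3_mult[OF c3 m k]])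
    moreover have "comm (\<phi> a) (comm (\<phi> b) v) - ?G \<in> Mk scB (k + 3)"
      using B.double_comm_inverse[OF t \<open>odd k\<close> ring_hom_Mk[OF assms(1,10,11) _ m]]
      by (simp add: v hom hom_comm assms(12))
    ultimately have "?G + (comm (\<phi> a) (comm (\<phi> b) v) - ?G) \<in> ?V" by blast
    then show ?thesis by (simp only: add_diff_eq add_diff_cancel_left')
  qed
  have "comm (\<phi> a) (comm (\<phi> b) v) \<in> ?V" if "v \<in> frac_span scB ?S \<phi> (Mk scA k)" for a b v
  proof -
    have "frac_span scB ?S \<phi> (Mk scA k) \<subseteq> {v. comm (\<phi> a) (comm (\<phi> b) v) \<in> ?V}"
      unfolding frac_span_def[of _ _ _ "Mk scA k"]
    proof (rule B.span_minimal)
      have "B.subspace {v. comm (\<phi> a) (comm (\<phi> b) v) \<in> W}" if "B.subspace W" for W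
        by (rule B.subspace_preimage[OF that]) (simp_all add: B.bilinear_simps)
      then show "B.subspace {v. comm (\<phi> a) (comm (\<phi> b) v) \<in> ?V}" using V .
    qed (use main in blast)
    then show ?thesis using that by blast
  qed
  then show ?thesis
    unfolding dcomm_def by (intro B.span_minimal V) blast
qed

end
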